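(* Let $G=(V,E)$ be a finite undirected graph with $V=\{1,\dots,n\}$ and positive edge weights, and consider problem (P). (a) For every nonempty proper subset $A\subsetneq V$, setting $\vec x=\vec 1_A-\vec 1_{V\setminus A}$ and $\mu=\frac{|\partial A|}{\min\{\mathrm{vol}(A),\mathrm{vol}(V\setminus A)\}}$, the pair $(\mu,\vec x)$ is an eigenpair of (P). (b) If $(\mu,\vec x)$ is an eigenpair of (P) with $\vec x$ nonconstant, then $\frac{\mathrm{vol}(V)\|\vec x\|_\infty-I^+(\vec x)}{N(\vec x)}=\mu$; moreover, for every eigenpair $(\mu,\vec x)$ of (P), $(\mu,\vec 1_{V_0^+(\vec x)}-\vec 1_{V_0^-(\vec x)})$ is also an eigenpair of (P), where $V_0^+(\vec x)=\{i:x_i>0\}$ and $V_0^-(\vec x)=\{i:x_i<0\}$.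
   Context: Edge weights $w_{ij}=w_{ji}>0$ for $\{i,j\}\in E$; degree $d_i=\sum_{j:\{i,j\}\in E}w_{ij}$; $\mathrm{vol}(S)=\sum_{i\in S}d_i$; for $A,B\subseteq V$, $|E(A,B)|=\sum_{i\in A,j\in B,\{i,j\}\in E}w_{ij}$ and $|\partial A|=|E(A,V\setminus A)|$. $\vec 1_S$ is the indicator vector of $S$. $I^+(\vec x)=\sum_{\{i,j\}\in E}w_{ij}|x_i+x_j|$, $\Delta_1^+\vec x=\partial I^+(\vec x)$ (convex subdifferential), $N(\vec x)=\min_{t\in\mathbb{R}}\sum_i d_i|x_i-t|$, $\|\vec x\|_\infty=\max_i|x_i|$. Problem (P): an eigenpair is $(\lambda,\vec x)$ with $\lambda\in\mathbb{R}$, $\vec x\in\mathbb{R}^n\setminus\{\vec 0\}$ and $\vec 0\in \mathrm{vol}(V)\,\partial\|\vec x\|_\infty-\Delta_1^+\vec x-\lambda\,\partial N(\vec x)$, i.e. there are $\vec u\in\partial\|\vec x\|_\infty$, $\vec s\in\partial I^+(\vec x)$, $\vec v\in\partial N(\vec x)$ with $\mathrm{vol}(V)\vec u-\vec s-\lambda\vec v=\vec 0$. (Note $\mathrm{vol}(V)$ equals twice the total edge weight.)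
   Formalization: In (b) the ratio formula is asserted only when N(x) ≠ 0, and N(x) ≠ 0 is proved for nonconstant x if all degrees are positive; with isolated vertices N(x) can vanish and the ratio is undefined. In (a), when the minimum volume is 0, μ is read as 0. *)

theory Defs
  imports "HOL-Analysis.Analysis"
begin

text \<open>
  The vertex set is the finite type \<open>'n\<close>, so that \<open>V = UNIV\<close> and vectors in
  \<open>\<real>\<^sup>n\<close> are of type \<open>real ^ 'n\<close>.  An edge is a two-element set of vertices.
  Weights are functions of the unordered edge: \<open>w {i, j}\<close> stands for
  \<open>w\<^sub>i\<^sub>j = w\<^sub>j\<^sub>i\<close>; the values of \<open>w\<close> outside \<open>E\<close> are never used.
\<close>

definition weighted_graph :: "'n::finite set set \<Rightarrow> ('n set \<Rightarrow> real) \<Rightarrow> bool" where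
  "weighted_graph E w \<longleftrightarrow> (\<forall>e\<in>E. card e = 2 \<and> w e > 0)"

definition wdegree :: "'n::finite set set \<Rightarrow> ('n set \<Rightarrow> real) \<Rightarrow> 'n \<Rightarrow> real" where
  "wdegree E w i = (\<Sum>j | {i, j} \<in> E. w {i, j})"

definition vol :: "'n::finite set set \<Rightarrow> ('n set \<Rightarrow> real) \<Rightarrow> 'n set \<Rightarrow> real" where
  "vol E w S = (\<Sum>i\<in>S. wdegree E w i)"

definition edge_weight ::
  "'n::finite set set \<Rightarrow> ('n set \<Rightarrow> real) \<Rightarrow> 'n set \<Rightarrow> 'n set \<Rightarrow> real" where
  "edge_weight E w A B = (\<Sum>(i, j) | i \<in> A \<and> j \<in> B \<and> {i, j} \<in> E. w {i, j})"

definition boundary_weight :: "'n::finite set set \<Rightarrow> ('n set \<Rightarrow> real) \<Rightarrow> 'n set \<Rightarrow> real" where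
  "boundary_weight E w A = edge_weight E w A (- A)"

definition indicator_vec :: "'n::finite set \<Rightarrow> real ^ 'n" where
  "indicator_vec S = (\<chi> i. indicator S i)"

text \<open>For an edge \<open>e = {i, j}\<close> the inner sum below is \<open>x\<^sub>i + x\<^sub>j\<close>; each edge is counted once.\<close>

definition I_plus :: "'n::finite set set \<Rightarrow> ('n set \<Rightarrow> real) \<Rightarrow> real ^ 'n \<Rightarrow> real" where
  "I_plus E w x = (\<Sum>e\<in>E. w e * \<bar>\<Sum>i\<in>e. x $ i\<bar>)"

text \<open>The infimum below is a minimum, see \<open>N_fun_attained\<close>.\<close>

definition N_fun :: "'n::finite set set \<Rightarrow> ('n set \<Rightarrow> real) \<Rightarrow> real ^ 'n \<Rightarrow> real" where
  "N_fun E w x = (INF t. \<Sum>i\<in>UNIV. wdegree E w i * \<bar>x $ i - t\<bar>)"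

definition subdifferential :: "('a::real_inner \<Rightarrow> real) \<Rightarrow> 'a \<Rightarrow> 'a set" where
  "subdifferential f x = {g. \<forall>y. f x + g \<bullet> (y - x) \<le> f y}"

definition signless_one_Laplacian ::
  "'n::finite set set \<Rightarrow> ('n set \<Rightarrow> real) \<Rightarrow> real ^ 'n \<Rightarrow> (real ^ 'n) set" where
  "signless_one_Laplacian E w x = subdifferential (I_plus E w) x"

text \<open>On \<open>real ^ 'n\<close> the norm \<^const>\<open>infnorm\<close> is the maximum of the \<open>\<bar>x $ i\<bar>\<close>.\<close>

definition eigenpair ::
  "'n::finite set set \<Rightarrow> ('n set \<Rightarrow> real) \<Rightarrow> real \<Rightarrow> real ^ 'n \<Rightarrow> bool" where
  "eigenpair E w \<mu> x \<longleftrightarrow> x \<noteq> 0 \<and>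
     (\<exists>u \<in> subdifferential infnorm x. \<exists>s \<in> signless_one_Laplacian E w x.
      \<exists>v \<in> subdifferential (N_fun E w) x.
        vol E w UNIV *\<^sub>R u - s - \<mu> *\<^sub>R v = 0)"

lemma wdegree_nonneg: "weighted_graph E w \<Longrightarrow> wdegree E w i \<ge> 0"
  unfolding wdegree_def weighted_graph_def by (rule sum_nonneg) (auto intro: less_imp_le)

lemma N_fun_attained:
  fixes x :: "real ^ 'n::finite"
  assumes "weighted_graph E w"
  shows "\<exists>t. N_fun E w x = (\<Sum>i\<in>UNIV. wdegree E w i * \<bar>x $ i - t\<bar>) \<and>
             (\<forall>t'. N_fun E w x \<le> (\<Sum>i\<in>UNIV. wdegree E w i * \<bar>x $ i - t'\<bar>))"
proof -
  define f where "f t = (\<Sum>i\<in>UNIV. wdegree E w i * \<bar>x $ i - t\<bar>)" for t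
  define M where "M = infnorm x"
  have M: "\<bar>x $ i\<bar> \<le> M" for i
    unfolding M_def by (rule component_le_infnorm_cart)
  then have "0 \<le> M"
    by (meson abs_ge_zero order_trans)
  moreover have "continuous_on {-M..M} f"
    unfolding f_def by (intro continuous_intros)
  ultimately obtain t where t: "\<forall>s\<in>{-M..M}. f t \<le> f s"
    using continuous_attains_inf[of "{-M..M}" f] by auto
  have min: "f t \<le> f s" for s
  proof -
    define c where "c = max (-M) (min M s)"
    have "f c \<le> f s"
      unfolding f_def
    proof (intro sum_mono mult_left_mono wdegree_nonneg assms)
      show "\<bar>x $ i - c\<bar> \<le> \<bar>x $ i - s\<bar>" for i
        using M[of i] unfolding c_def by linarith
    qed
    moreover have "c \<in> {-M..M}"
      using \<open>0 \<le> M\<close> by (auto simp: c_def)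
    ultimately show ?thesis
      using t by (meson order_trans)
  qed
  have "N_fun E w x = f t"
    unfolding N_fun_def f_def[symmetric] by (rule cInf_eq_minimum) (use min in auto)
  then show ?thesis
    using min unfolding f_def by auto
qed

end

theory Submission
  imports Defs
begin

text \<open>
  All three functions are positively homogeneous, so \<open>g\<close> is a subgradient of \<open>f\<close> at \<open>x\<close> iff
  \<open>g \<bullet> x = f x\<close> and \<open>g \<bullet> y \<le> f y\<close> for all \<open>y\<close>. Pairing the eigenvalue equation with \<open>x\<close> gives the
  formula for \<open>\<mu>\<close>.

  For small \<open>a > 0\<close> the vector \<open>a sgn x\<close> is the truncation of \<open>x\<close> to \<open>[-a, a]\<close>, and each of the three
  functions is additive along the splitting \<open>x = a sgn x + (x - a sgn x)\<close>. Hence every subgradient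
  at \<open>x\<close> is one at \<open>sgn x\<close>, and an eigenpair stays one when \<open>x\<close> is replaced by \<open>sgn x\<close>.

  For a cut vector \<open>x = \<plusminus>1\<close> take the subgradient \<open>s\<close> of \<open>I\<^sup>+\<close> that is \<open>0\<close> on crossing edges, and a
  subgradient \<open>v\<close> of \<open>N\<close> proportional to the degrees on either side of the cut. Then \<open>s + \<mu> v\<close> has
  the signs of \<open>x\<close>, and \<open>(s + \<mu> v) \<bullet> x = I\<^sup>+ x + \<mu> N x = vol V\<close>, so that it is \<open>vol V\<close> times a
  subgradient of the maximum norm.
\<close>

section \<open>Subgradients of positively homogeneous functions\<close>

lemma subdifferential_pos_homogeneous_iff:
  fixes f :: "'a::real_inner \<Rightarrow> real"
  assumes hom: "\<And>c x. c > 0 \<Longrightarrow> f (c *\<^sub>R x) = c * f x"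
  shows "g \<in> subdifferential f x \<longleftrightarrow> g \<bullet> x = f x \<and> (\<forall>y. g \<bullet> y \<le> f y)"
proof
  assume "g \<in> subdifferential f x"
  then have g: "f x + g \<bullet> (y - x) \<le> f y" for y
    by (simp add: subdifferential_def)
  \<comment> \<open>The test points \<open>0\<close> and \<open>2 *\<^sub>R x\<close> bound
    \<open>g \<bullet> x\<close> from below and from above.\<close>
  have "f 0 = 0"
    using hom[of 2 0] by simp
  then have "f x \<le> g \<bullet> x"
    using g[of 0] by (simp add: inner_diff_right)
  moreover have "g \<bullet> x \<le> f x"
    using g[of "2 *\<^sub>R x"] hom[of 2 x] by (simp add: inner_diff_right)
  ultimately have "g \<bullet> x = f x"
    by simp
  moreover have "g \<bullet> y \<le> f y" for y
    using g[of y] \<open>g \<bullet> x = f x\<close> by (simp add: inner_diff_right)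
  ultimately show "g \<bullet> x = f x \<and> (\<forall>y. g \<bullet> y \<le> f y)"
    by simp
qed (simp add: subdifferential_def inner_diff_right)

text \<open>A subgradient at \<open>x\<close> attains \<open>f x\<close> but is at most
  \<open>f\<close> on each summand of \<open>x = a *\<^sub>R y + (x - a *\<^sub>R y)\<close>. By
  \<open>add\<close> it must attain \<open>f\<close> on both, in particular at
  \<open>a *\<^sub>R y\<close>.\<close>

lemma subdifferential_subset_of_additive:
  fixes f :: "'a::real_inner \<Rightarrow> real"
  assumes hom: "\<And>c x. c > 0 \<Longrightarrow> f (c *\<^sub>R x) = c * f x"
    and "a > 0" and add: "f (a *\<^sub>R y) + f (x - a *\<^sub>R y) \<le> f x"
  shows "subdifferential f x \<subseteq> subdifferential f y"
proof
  fix g assume "g \<in> subdifferential f x"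
  then have g: "g \<bullet> x = f x" "g \<bullet> z \<le> f z" for z
    using subdifferential_pos_homogeneous_iff[of f, OF hom] by auto
  have "a * f y \<le> g \<bullet> x - g \<bullet> (x - a *\<^sub>R y)"
    using add hom[OF \<open>a > 0\<close>, of y] g(1) g(2)[of "x - a *\<^sub>R y"] by linarith
  then have "a * f y \<le> a * (g \<bullet> y)"
    by (simp add: inner_diff_right)
  then have "f y \<le> g \<bullet> y"
    using \<open>a > 0\<close> by simp
  then show "g \<in> subdifferential f y"
    using subdifferential_pos_homogeneous_iff[of f, OF hom] g(2) by (auto intro: antisym)
qed

section \<open>Homogeneity of the three functions\<close>

lemma infnorm_le_cart:
  fixes x :: "real ^ 'n::finite"
  assumes "\<And>i. \<bar>x $ i\<bar> \<le> B"
  shows "infnorm x \<le> B"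
  unfolding infnorm_cart by (rule cSup_least) (use assms in auto)

lemma infnorm_pos_homogeneous: "c > 0 \<Longrightarrow> infnorm (c *\<^sub>R x) = c * infnorm x"
  by (simp add: infnorm_mul)

lemma I_plus_pos_homogeneous: "c > 0 \<Longrightarrow> I_plus E w (c *\<^sub>R x) = c * I_plus E w x"
  unfolding I_plus_def sum_distrib_left[of c "\<lambda>e. w e * _ e"]
  by (intro sum.cong refl) (simp add: abs_mult flip: sum_distrib_left)

lemma N_fun_le:
  assumes "weighted_graph E w"
  shows "N_fun E w x \<le> (\<Sum>i\<in>UNIV. wdegree E w i * \<bar>x $ i - t\<bar>)"
  using N_fun_attained[OF assms, of x] by blast

lemma N_fun_pos_homogeneous:
  assumes G: "weighted_graph E w" and "c > 0"
  shows "N_fun E w (c *\<^sub>R x) = c * N_fun E w x"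
proof -
  have le: "N_fun E w (c *\<^sub>R x) \<le> c * N_fun E w x" if "c > 0" for c and x :: "real ^ 'a"
  proof -
    obtain t where t: "N_fun E w x = (\<Sum>i\<in>UNIV. wdegree E w i * \<bar>x $ i - t\<bar>)"
      using N_fun_attained[OF G] by blast
    have "\<bar>c * x $ i - c * t\<bar> = c * \<bar>x $ i - t\<bar>" for i
      using that by (simp add: abs_mult flip: right_diff_distrib)
    then show ?thesis
      using N_fun_le[OF G, of "c *\<^sub>R x" "c * t"] by (simp add: t sum_distrib_left mult_ac)
  qed
  \<comment> \<open>The reverse inequality is \<open>le\<close> again, with factor
    \<open>1 / c\<close> at the vector \<open>c *\<^sub>R x\<close>.\<close>
  have "c * N_fun E w x = c * N_fun E w ((1 / c) *\<^sub>R c *\<^sub>R x)"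
    using \<open>c > 0\<close> by simp
  also have "\<dots> \<le> c * (1 / c * N_fun E w (c *\<^sub>R x))"
    using \<open>c > 0\<close> by (intro mult_left_mono le) auto
  also have "\<dots> = N_fun E w (c *\<^sub>R x)"
    using \<open>c > 0\<close> by simp
  finally show ?thesis
    using le[OF \<open>c > 0\<close>, of x] by simp
qed

lemmas subdifferential_infnorm_iff =
  subdifferential_pos_homogeneous_iff[of infnorm, OF infnorm_pos_homogeneous]

lemmas subdifferential_I_plus_iff =
  subdifferential_pos_homogeneous_iff[of "I_plus E w" for E w, OF I_plus_pos_homogeneous]

lemmas subdifferential_N_fun_iff =
  subdifferential_pos_homogeneous_iff[of "N_fun E w" for E w, OF N_fun_pos_homogeneous]

section \<open>Passing from \<open>x\<close> to its sign vector\<close>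

definition sgn_vec :: "real ^ 'n::finite \<Rightarrow> real ^ 'n" where
  "sgn_vec x = (\<chi> i. sgn (x $ i))"

lemma sgn_vec_nth [simp]: "sgn_vec x $ i = sgn (x $ i)"
  by (simp add: sgn_vec_def)

lemma indicator_diff_eq_sgn_vec:
  "indicator_vec {i. x $ i > 0} - indicator_vec {i. x $ i < 0} = sgn_vec x"
  by (simp add: vec_eq_iff indicator_vec_def sgn_if indicator_def)

lemma exists_gap_at_zero:
  fixes x :: "real ^ 'n::finite"
  shows "\<exists>a>0. \<forall>i. x $ i \<noteq> 0 \<longrightarrow> a \<le> \<bar>x $ i\<bar>"
proof (intro exI conjI allI impI)
  \<comment> \<open>Inserting \<open>1\<close> keeps the set nonempty when
    \<open>x = 0\<close>.\<close>
  let ?S = "insert 1 ((\<lambda>i. \<bar>x $ i\<bar>) ` {i. x $ i \<noteq> 0})"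
  show "Min ?S > 0"
    by (subst Min_gr_iff) auto
  show "Min ?S \<le> \<bar>x $ i\<bar>" if "x $ i \<noteq> 0" for i
    using that by (intro Min_le) auto
qed

lemma subdifferential_infnorm_sgn_vec:
  fixes x :: "real ^ 'n::finite"
  assumes "x \<noteq> 0"
  shows "subdifferential infnorm x \<subseteq> subdifferential infnorm (sgn_vec x)"
proof -
  obtain a where a: "a > 0" "\<And>i. x $ i \<noteq> 0 \<Longrightarrow> a \<le> \<bar>x $ i\<bar>"
    using exists_gap_at_zero[of x] by blast
  \<comment> \<open>A nonzero entry gives \<open>a \<le> infnorm x\<close>; the bound on
    \<open>x - a *\<^sub>R sgn_vec x\<close> needs this at the zero entries of
    \<open>x\<close>.\<close>
  obtain k where "x $ k \<noteq> 0"
    using \<open>x \<noteq> 0\<close> by (auto simp: vec_eq_iff)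
  then have a_le: "a \<le> infnorm x"
    using a(2) component_le_infnorm_cart[of x k] by force
  have "infnorm (a *\<^sub>R sgn_vec x) \<le> a"
    using a(1) by (intro infnorm_le_cart) (auto simp: sgn_if)
  moreover have "infnorm (x - a *\<^sub>R sgn_vec x) \<le> infnorm x - a"
  proof (rule infnorm_le_cart)
    fix i
    show "\<bar>(x - a *\<^sub>R sgn_vec x) $ i\<bar> \<le> infnorm x - a"
      using a(2)[of i] a_le component_le_infnorm_cart[of x i]
      by (cases "x $ i" "0::real" rule: linorder_cases) auto
  qed
  ultimately show ?thesis
    by (intro subdifferential_subset_of_additive[OF infnorm_pos_homogeneous a(1)]) auto
qed

text \<open>Truncation to [-a, a] and its remainder are both odd and nondecreasing. On each edge the
  two sums over the endpoints therefore never have opposite signs, and their absolute values add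
  up.\<close>

lemma subdifferential_I_plus_sgn_vec:
  fixes x :: "real ^ 'n::finite"
  assumes G: "weighted_graph E w"
  shows "subdifferential (I_plus E w) x \<subseteq> subdifferential (I_plus E w) (sgn_vec x)"
proof -
  obtain a where a: "a > 0" "\<And>i. x $ i \<noteq> 0 \<Longrightarrow> a \<le> \<bar>x $ i\<bar>"
    using exists_gap_at_zero[of x] by blast
  let ?y = "a *\<^sub>R sgn_vec x" and ?z = "x - a *\<^sub>R sgn_vec x"
  have "I_plus E w ?y + I_plus E w ?z =
      (\<Sum>e\<in>E. w e * (\<bar>\<Sum>i\<in>e. ?y $ i\<bar> + \<bar>\<Sum>i\<in>e. ?z $ i\<bar>))"
    by (simp add: I_plus_def sum.distrib distrib_left)
  also have "\<dots> \<le> I_plus E w x"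
    unfolding I_plus_def
  proof (intro sum_mono mult_left_mono)
    fix e assume "e \<in> E"
    then have "card e = 2" "w e > 0"
      using G by (auto simp: weighted_graph_def)
    then show "w e \<ge> 0"
      by simp
    obtain i j where "e = {i, j}" "i \<noteq> j"
      using \<open>card e = 2\<close> by (auto simp: card_2_iff)
    then show "\<bar>\<Sum>i\<in>e. ?y $ i\<bar> + \<bar>\<Sum>i\<in>e. ?z $ i\<bar> \<le> \<bar>\<Sum>i\<in>e. x $ i\<bar>"
      using a(1) a(2)[of i] a(2)[of j]
      by (cases "x $ i" "0::real" rule: linorder_cases;
          cases "x $ j" "0::real" rule: linorder_cases) auto
  qed
  finally show ?thesis
    by (intro subdifferential_subset_of_additive[OF I_plus_pos_homogeneous a(1)])
qed

text \<open>An optimal shift \<open>t\<close> for \<open>x\<close> is split like the entries, into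
  \<open>clip t\<close> and \<open>t - clip t\<close>. Since \<open>clip\<close> and its remainder
  are nondecreasing, each distance \<bar>x_i - t\<bar> is the sum of the two partial
  distances.\<close>

lemma subdifferential_N_fun_sgn_vec:
  fixes x :: "real ^ 'n::finite"
  assumes G: "weighted_graph E w"
  shows "subdifferential (N_fun E w) x \<subseteq> subdifferential (N_fun E w) (sgn_vec x)"
proof -
  obtain a where a: "a > 0" "\<And>i. x $ i \<noteq> 0 \<Longrightarrow> a \<le> \<bar>x $ i\<bar>"
    using exists_gap_at_zero[of x] by blast
  let ?y = "a *\<^sub>R sgn_vec x" and ?z = "x - a *\<^sub>R sgn_vec x"
  obtain t where t: "N_fun E w x = (\<Sum>i\<in>UNIV. wdegree E w i * \<bar>x $ i - t\<bar>)"
    using N_fun_attained[OF G] by blast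
  define clip where "clip r = max (- a) (min a r)" for r
  have y: "?y $ i = clip (x $ i)" for i
    using a(1) a(2)[of i] by (auto simp: clip_def sgn_if)
  have "N_fun E w ?y + N_fun E w ?z \<le>
      (\<Sum>i\<in>UNIV. wdegree E w i * \<bar>?y $ i - clip t\<bar>) +
      (\<Sum>i\<in>UNIV. wdegree E w i * \<bar>?z $ i - (t - clip t)\<bar>)"
    by (intro add_mono N_fun_le G)
  also have "\<dots> =
      (\<Sum>i\<in>UNIV. wdegree E w i * (\<bar>?y $ i - clip t\<bar> + \<bar>?z $ i - (t - clip t)\<bar>))"
    by (simp add: sum.distrib distrib_left)
  also have "\<dots> \<le> N_fun E w x"
    unfolding t
  proof (intro sum_mono mult_left_mono wdegree_nonneg G)
    fix i
    have "?z $ i = x $ i - clip (x $ i)"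
      using y[of i] by simp
    then show "\<bar>?y $ i - clip t\<bar> + \<bar>?z $ i - (t - clip t)\<bar> \<le> \<bar>x $ i - t\<bar>"
      unfolding y clip_def using a(1) by (auto simp: max_def min_def)
  qed
  finally show ?thesis
    by (intro subdifferential_subset_of_additive[OF N_fun_pos_homogeneous[OF G] a(1)])
qed

lemma eigenpair_sgn_vec:
  assumes G: "weighted_graph E w" and "eigenpair E w \<mu> x"
  shows "eigenpair E w \<mu> (sgn_vec x)"
proof -
  have "x \<noteq> 0"
    using assms(2) by (simp add: eigenpair_def)
  then have "sgn_vec x \<noteq> 0"
    by (auto simp: vec_eq_iff sgn_zero_iff)
  then show ?thesis
    using assms(2) subdifferential_infnorm_sgn_vec[OF \<open>x \<noteq> 0\<close>]
      subdifferential_I_plus_sgn_vec[OF G, of x] subdifferential_N_fun_sgn_vec[OF G, of x]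
    unfolding eigenpair_def signless_one_Laplacian_def by blast
qed

section \<open>The eigenvalue formula and its denominator\<close>

lemma eigenpair_eigenvalue:
  assumes G: "weighted_graph E w" and "eigenpair E w \<mu> x"
  shows "vol E w UNIV * infnorm x - I_plus E w x = \<mu> * N_fun E w x"
proof -
  obtain u s v where u: "u \<in> subdifferential infnorm x"
    and s: "s \<in> subdifferential (I_plus E w) x"
    and v: "v \<in> subdifferential (N_fun E w) x"
    and eq: "vol E w UNIV *\<^sub>R u - s - \<mu> *\<^sub>R v = 0"
    using assms(2) by (auto simp: eigenpair_def signless_one_Laplacian_def)
  have "(vol E w UNIV *\<^sub>R u - s - \<mu> *\<^sub>R v) \<bullet> x = 0"
    using eq by simp
  then show ?thesis
    using u s v
    by (simp add: inner_diff_left subdifferential_infnorm_iff subdifferential_I_plus_iff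
        subdifferential_N_fun_iff[OF G])
qed

text \<open>Secures the denominator in (b). Positive degrees exclude isolated vertices, whose
  entries have weight zero in \<open>N_fun\<close> and could vary freely.\<close>

lemma N_fun_eq_0_imp_constant:
  assumes G: "weighted_graph E w" and "\<And>i. wdegree E w i > 0" and "N_fun E w x = 0"
  shows "\<exists>c. \<forall>i. x $ i = c"
proof -
  obtain t where "N_fun E w x = (\<Sum>i\<in>UNIV. wdegree E w i * \<bar>x $ i - t\<bar>)"
    using N_fun_attained[OF G] by blast
  then have "wdegree E w i * \<bar>x $ i - t\<bar> = 0" for i
    using assms(3) wdegree_nonneg[OF G]
      sum_nonneg_eq_0_iff[of UNIV "\<lambda>i. wdegree E w i * \<bar>x $ i - t\<bar>"] by simp
  then show ?thesis
    using assms(2) by (metis abs_0_eq eq_iff_diff_eq_0 less_irrefl mult_eq_0_iff)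
qed

section \<open>Incidence sums, boundaries and volumes\<close>

lemma sum_neighbours_eq_sum_incident:
  fixes f :: "'n::finite set \<Rightarrow> real"
  assumes G: "weighted_graph E w"
  shows "(\<Sum>j | {i, j} \<in> E. f {i, j}) = (\<Sum>e | e \<in> E \<and> i \<in> e. f e)"
proof (rule sum.reindex_cong[symmetric])
  show "inj_on (\<lambda>j. {i, j}) {j. {i, j} \<in> E}"
    by (auto simp: inj_on_def doubleton_eq_iff)
  show "{e. e \<in> E \<and> i \<in> e} = (\<lambda>j. {i, j}) ` {j. {i, j} \<in> E}"
  proof (intro equalityI subsetI)
    fix e assume e: "e \<in> {e. e \<in> E \<and> i \<in> e}"
    then have "card e = 2"
      using G by (simp add: weighted_graph_def)
    then obtain j where "e = {i, j}"
      using e by (auto simp: card_2_iff)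
    then show "e \<in> (\<lambda>j. {i, j}) ` {j. {i, j} \<in> E}"
      using e by auto
  qed auto
qed simp

lemma sum_vertices_incident:
  fixes f :: "'n::finite set \<Rightarrow> 'n \<Rightarrow> real"
  shows "(\<Sum>i\<in>UNIV. \<Sum>e | e \<in> E \<and> i \<in> e. f e i) = (\<Sum>e\<in>E. \<Sum>i\<in>e. f e i)"
  using sum.swap_restrict[of UNIV E "\<lambda>i e. f e i" "\<lambda>i e. i \<in> e"] by simp

lemma edge_weight_eq_sum:
  "edge_weight E w A B = (\<Sum>i\<in>A. \<Sum>j | j \<in> B \<and> {i, j} \<in> E. w {i, j})"
proof -
  have "{(i, j). i \<in> A \<and> j \<in> B \<and> {i, j} \<in> E} = (SIGMA i:A. {j. j \<in> B \<and> {i, j} \<in> E})"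
    by auto
  then show ?thesis
    by (simp add: edge_weight_def sum.Sigma)
qed

lemma edge_weight_commute: "edge_weight E w A B = edge_weight E w B A"
  unfolding edge_weight_def
  by (rule sum.reindex_bij_witness[of _ prod.swap prod.swap]) (auto simp: insert_commute)

lemma boundary_weight_Compl: "boundary_weight E w (- A) = boundary_weight E w A"
  by (simp add: boundary_weight_def edge_weight_commute[of _ _ "- A"])

lemma boundary_weight_nonneg: "weighted_graph E w \<Longrightarrow> boundary_weight E w A \<ge> 0"
  unfolding boundary_weight_def edge_weight_def weighted_graph_def
  by (rule sum_nonneg) (auto intro: less_imp_le)

text \<open>Boundary edges are among those counted by the degrees in \<open>A\<close>. Consequently
  the boundary weight vanishes whenever the denominator in (a) does.\<close>

lemma boundary_weight_le_vol:
  assumes "weighted_graph E w"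
  shows "boundary_weight E w A \<le> vol E w A"
  unfolding boundary_weight_def edge_weight_eq_sum vol_def wdegree_def
  using assms by (intro sum_mono sum_mono2) (auto simp: weighted_graph_def intro: less_imp_le)

lemma vol_nonneg: "weighted_graph E w \<Longrightarrow> vol E w A \<ge> 0"
  unfolding vol_def by (intro sum_nonneg wdegree_nonneg)

lemma sum_UNIV_split:
  fixes f :: "'n::finite \<Rightarrow> real"
  shows "(\<Sum>i\<in>UNIV. f i) = (\<Sum>i\<in>A. f i) + (\<Sum>i\<in>- A. f i)"
  using sum.subset_diff[of A UNIV f] by (simp add: Compl_eq_Diff_UNIV)

section \<open>Cut vectors as eigenvectors\<close>

definition cut_vec :: "'n::finite set \<Rightarrow> real ^ 'n" where
  "cut_vec A = indicator_vec A - indicator_vec (- A)"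

lemma cut_vec_nth [simp]: "cut_vec A $ i = (if i \<in> A then 1 else - 1)"
  by (simp add: cut_vec_def indicator_vec_def)

text \<open>An edge inside one side contributes twice its weight, a crossing edge nothing. Summing
  over ordered pairs counts each edge twice, a crossing edge once from either side.\<close>

lemma I_plus_cut_vec:
  fixes E :: "'n::finite set set"
  assumes G: "weighted_graph E w"
  shows "I_plus E w (cut_vec A) = vol E w UNIV - 2 * boundary_weight E w A"
proof -
  define F where "F e = w e * \<bar>\<Sum>i\<in>e. cut_vec A $ i\<bar>" for e
  have ne: "i \<noteq> j" if "{i, j} \<in> E" for i j
    using that G by (auto simp: weighted_graph_def)
  have pt: "F {i, j} = 2 * w {i, j} - 2 * (if (i \<in> A) \<noteq> (j \<in> A) then w {i, j} else 0)"
    if "{i, j} \<in> E" for i j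
    using ne[OF that] G that by (auto simp: F_def weighted_graph_def)
  have cut: "boundary_weight E w B =
      (\<Sum>i\<in>B. \<Sum>j | {i, j} \<in> E. if j \<notin> B then w {i, j} else 0)" for B
    unfolding boundary_weight_def edge_weight_eq_sum
    by (intro sum.cong refl sum.mono_neutral_cong_left) auto
  have "2 * I_plus E w (cut_vec A) = (\<Sum>e\<in>E. \<Sum>i\<in>e. F e)"
    using G by (simp add: I_plus_def F_def sum_distrib_left weighted_graph_def)
  also have "\<dots> = (\<Sum>i\<in>UNIV. \<Sum>j | {i, j} \<in> E. F {i, j})"
    by (simp add: sum_neighbours_eq_sum_incident[OF G] sum_vertices_incident)
  also have "\<dots> = (\<Sum>i\<in>UNIV. \<Sum>j | {i, j} \<in> E.
      2 * w {i, j} - 2 * (if (i \<in> A) \<noteq> (j \<in> A) then w {i, j} else 0))"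
    by (intro sum.cong refl pt) auto
  also have "\<dots> = 2 * vol E w UNIV
      - 2 * (\<Sum>i\<in>UNIV. \<Sum>j | {i, j} \<in> E. if (i \<in> A) \<noteq> (j \<in> A) then w {i, j} else 0)"
    by (simp add: sum_subtractf vol_def wdegree_def flip: sum_distrib_left)
  also have "(\<Sum>i\<in>UNIV. \<Sum>j | {i, j} \<in> E. if (i \<in> A) \<noteq> (j \<in> A) then w {i, j} else 0) =
      boundary_weight E w A + boundary_weight E w (- A)"
    unfolding cut by (subst sum_UNIV_split[of _ A]) (auto intro!: arg_cong2[of _ _ _ _ "(+)"] sum.cong)
  finally show ?thesis
    by (simp add: boundary_weight_Compl)
qed

lemma exists_sign_compatible_I_plus_subgradient:
  fixes x :: "real ^ 'n::finite"
  assumes G: "weighted_graph E w" and same_abs: "\<And>i j. \<bar>x $ i\<bar> = \<bar>x $ j\<bar>"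
  obtains s where "s \<in> subdifferential (I_plus E w) x" "\<And>i. x $ i * s $ i \<ge> 0"
proof
  \<comment> \<open>Where the edge sum is 0, any value in [-1, 1] would give a subgradient;
    \<open>sgn\<close> picks 0.\<close>
  define z where "z e = sgn (\<Sum>i\<in>e. x $ i)" for e
  define s :: "real ^ 'n" where "s = (\<chi> i. \<Sum>e | e \<in> E \<and> i \<in> e. w e * z e)"
  have inner: "s \<bullet> y = (\<Sum>e\<in>E. w e * (z e * (\<Sum>i\<in>e. y $ i)))" for y
    using sum_vertices_incident[of "\<lambda>e i. w e * z e * y $ i" E]
    by (simp add: s_def inner_vec_def sum_distrib_right sum_distrib_left mult_ac)
  have "s \<bullet> y \<le> I_plus E w y" for y
    unfolding inner I_plus_def
  proof (intro sum_mono mult_left_mono)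
    show "z e * (\<Sum>i\<in>e. y $ i) \<le> \<bar>\<Sum>i\<in>e. y $ i\<bar>" for e
      by (auto simp: z_def sgn_if)
  qed (use G in \<open>auto simp: weighted_graph_def less_imp_le\<close>)
  moreover have "s \<bullet> x = I_plus E w x"
    unfolding inner I_plus_def by (intro sum.cong refl) (auto simp: z_def sgn_if)
  ultimately show "s \<in> subdifferential (I_plus E w) x"
    by (simp add: subdifferential_I_plus_iff)
  show "x $ i * s $ i \<ge> 0" for i
  proof -
    have "x $ i * (w e * z e) \<ge> 0" if "e \<in> E" "i \<in> e" for e
    proof -
      have "card e = 2" "w e > 0"
        using G that by (auto simp: weighted_graph_def)
      then obtain j where "e = {i, j}" "i \<noteq> j"
        using \<open>i \<in> e\<close> by (auto simp: card_2_iff)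
      \<comment> \<open>Equal absolute values make x_i + x_j either 2 x_i or 0.\<close>
      then have "x $ i * z e \<ge> 0"
        using same_abs[of i j] by (auto simp: z_def sgn_if)
      then show ?thesis
        using \<open>w e > 0\<close> by (metis less_imp_le mult.left_commute mult_nonneg_nonneg)
    qed
    then show ?thesis
      by (auto simp: s_def sum_distrib_left intro!: sum_nonneg)
  qed
qed

text \<open>Any \<open>v\<close> with zero sum and entries bounded by the degrees lies below
  \<open>N_fun\<close>, since \<open>v\<close> does not see the shift \<open>t\<close>. The value
  \<open>2 * m\<close> of \<open>v\<close> at the cut vector is also an upper bound for
  \<open>N_fun\<close> there.\<close>

lemma exists_cut_vec_N_fun_subgradient:
  fixes E :: "'n::finite set set"
  assumes G: "weighted_graph E w"
  obtains v where "v \<in> subdifferential (N_fun E w) (cut_vec A)"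
    "\<And>i. cut_vec A $ i * v $ i \<ge> 0"
    "N_fun E w (cut_vec A) = 2 * min (vol E w A) (vol E w (- A))"
proof
  let ?x = "cut_vec A"
  define m where "m = min (vol E w A) (vol E w (- A))"
  \<comment> \<open>Scaling the degrees so that each side has total \<open>m\<close> makes
    \<open>v\<close> sum to zero; \<open>m\<close> is the smaller volume, so no degree
    grows.\<close>
  define r where "r i = m / (if i \<in> A then vol E w A else vol E w (- A))" for i
  define v :: "real ^ 'n" where "v = (\<chi> i. ?x $ i * (wdegree E w i * r i))"
  have r: "0 \<le> r i" "r i \<le> 1" for i
    using vol_nonneg[OF G, of A] vol_nonneg[OF G, of "- A"]
    by (auto simp: r_def m_def divide_le_eq_1)
  \<comment> \<open>If \<open>vol E w A = 0\<close> then \<open>r = 0\<close> on \<open>A\<close> by division by zero, but then also \<open>m = 0\<close>.\<close>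
  have "(\<Sum>i\<in>A. wdegree E w i * r i) = vol E w A * (m / vol E w A)"
    unfolding vol_def[of E w] sum_distrib_right by (intro sum.cong) (auto simp: r_def vol_def)
  then have sum_A: "(\<Sum>i\<in>A. wdegree E w i * r i) = m"
    using vol_nonneg[OF G, of A] vol_nonneg[OF G, of "- A"]
    by (cases "vol E w A = 0") (auto simp: m_def)
  have "(\<Sum>i\<in>- A. wdegree E w i * r i) = vol E w (- A) * (m / vol E w (- A))"
    unfolding vol_def[of E w] sum_distrib_right by (intro sum.cong) (auto simp: r_def vol_def)
  then have sum_B: "(\<Sum>i\<in>- A. wdegree E w i * r i) = m"
    using vol_nonneg[OF G, of A] vol_nonneg[OF G, of "- A"]
    by (cases "vol E w (- A) = 0") (auto simp: m_def)
  have sum_v: "(\<Sum>i\<in>UNIV. v $ i) = 0"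
    using sum_A sum_B by (subst sum_UNIV_split[of _ A]) (simp add: v_def sum_negf)
  have v_x: "v \<bullet> ?x = 2 * m"
    using sum_A sum_B unfolding inner_vec_def
    by (subst sum_UNIV_split[of _ A]) (simp add: v_def)
  have abs_v: "\<bar>v $ i\<bar> \<le> wdegree E w i" for i
    using r[of i] wdegree_nonneg[OF G, of i] by (simp add: v_def abs_mult mult_left_le)
  have v_le: "v \<bullet> y \<le> N_fun E w y" for y
  proof -
    obtain t where t: "N_fun E w y = (\<Sum>i\<in>UNIV. wdegree E w i * \<bar>y $ i - t\<bar>)"
      using N_fun_attained[OF G] by blast
    have "v \<bullet> y = (\<Sum>i\<in>UNIV. v $ i * (y $ i - t))"
      using sum_v by (simp add: inner_vec_def right_diff_distrib sum_subtractf flip: sum_distrib_right)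
    also have "\<dots> \<le> N_fun E w y"
      unfolding t
    proof (rule sum_mono)
      fix i
      have "v $ i * (y $ i - t) \<le> \<bar>v $ i\<bar> * \<bar>y $ i - t\<bar>"
        by (metis abs_ge_self abs_mult)
      also have "\<dots> \<le> wdegree E w i * \<bar>y $ i - t\<bar>"
        by (intro mult_right_mono abs_v) simp
      finally show "v $ i * (y $ i - t) \<le> wdegree E w i * \<bar>y $ i - t\<bar>" .
    qed
    finally show ?thesis .
  qed
  \<comment> \<open>The shifts -1 and 1 cancel the entries outside and inside \<open>A\<close>,
    respectively.\<close>
  have "N_fun E w ?x \<le> 2 * vol E w A"
    using N_fun_le[OF G, of ?x "- 1"]
    by (subst (asm) sum_UNIV_split[of _ A]) (simp add: vol_def sum_distrib_left mult.commute)
  moreover have "N_fun E w ?x \<le> 2 * vol E w (- A)"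
    using N_fun_le[OF G, of ?x 1]
    by (subst (asm) sum_UNIV_split[of _ A]) (simp add: vol_def sum_distrib_left mult.commute)
  ultimately have N: "N_fun E w ?x = 2 * m"
    using v_le[of ?x] v_x by (simp add: m_def)
  then show "N_fun E w ?x = 2 * min (vol E w A) (vol E w (- A))"
    by (simp add: m_def)
  show "v \<in> subdifferential (N_fun E w) ?x"
    using v_x N v_le by (simp add: subdifferential_N_fun_iff[OF G])
  show "?x $ i * v $ i \<ge> 0" for i
    using r[of i] wdegree_nonneg[OF G, of i] by (simp add: v_def)
qed

text \<open>Matching signs turn \<open>u \<bullet> x = 1\<close> into l1-norm 1 of \<open>u\<close>,
  and the l1-norm is dual to the maximum norm.\<close>

lemma sign_compatible_infnorm_subgradient:
  fixes u x :: "real ^ 'n::finite"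
  assumes x: "\<And>i. \<bar>x $ i\<bar> = 1" and "\<And>i. x $ i * u $ i \<ge> 0" and "u \<bullet> x = 1"
  shows "u \<in> subdifferential infnorm x"
proof -
  have "\<bar>u $ i\<bar> = u $ i * x $ i" for i
    using x[of i] assms(2)[of i] by (metis abs_mult abs_of_nonneg mult.commute mult.left_neutral)
  then have abs_u: "(\<Sum>i\<in>UNIV. \<bar>u $ i\<bar>) = 1"
    using \<open>u \<bullet> x = 1\<close> by (simp add: inner_vec_def)
  have le: "u \<bullet> y \<le> infnorm y" for y
  proof -
    have "u \<bullet> y \<le> (\<Sum>i\<in>UNIV. \<bar>u $ i\<bar> * infnorm y)"
      unfolding inner_vec_def
    proof (rule sum_mono)
      fix i
      have "u $ i * y $ i \<le> \<bar>u $ i\<bar> * \<bar>y $ i\<bar>"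
        by (metis abs_ge_self abs_mult)
      also have "\<dots> \<le> \<bar>u $ i\<bar> * infnorm y"
        by (intro mult_left_mono component_le_infnorm_cart) simp
      finally show "u $ i \<bullet> y $ i \<le> \<bar>u $ i\<bar> * infnorm y"
        by simp
    qed
    then show ?thesis
      using abs_u by (simp flip: sum_distrib_right)
  qed
  moreover have "infnorm x \<le> 1"
    by (rule infnorm_le_cart) (simp add: x)
  ultimately show ?thesis
    using \<open>u \<bullet> x = 1\<close> le[of x] by (simp add: subdifferential_infnorm_iff)
qed

lemma exists_scaled_infnorm_subgradient:
  fixes b x :: "real ^ 'n::finite"
  assumes x: "\<And>i. \<bar>x $ i\<bar> = 1" and b: "\<And>i. x $ i * b $ i \<ge> 0"
  obtains u where "u \<in> subdifferential infnorm x" "(b \<bullet> x) *\<^sub>R u = b"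
proof (cases "b \<bullet> x = 0")
  case True
  then have "\<forall>i\<in>UNIV. b $ i * x $ i = 0"
    using b by (subst sum_nonneg_eq_0_iff[symmetric]) (auto simp: inner_vec_def mult.commute)
  then have "b = 0"
    using x by (auto simp: vec_eq_iff) (metis abs_zero zero_neq_one)
  have xx: "x $ i * x $ i = 1" for i
    using x[of i] by (metis abs_mult_self_eq mult.left_neutral)
  \<comment> \<open>Here \<open>b = 0\<close>, so any subgradient serves; the uniform multiple of
    \<open>x\<close> is one.\<close>
  have "(1 / CARD('n)) *\<^sub>R x \<in> subdifferential infnorm x"
    by (rule sign_compatible_infnorm_subgradient)
      (use x xx in \<open>auto simp: inner_vec_def\<close>)
  then show thesis
    using that \<open>b = 0\<close> by simp
next
  case False
  have "b \<bullet> x \<ge> 0"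
    using b by (auto simp: inner_vec_def mult.commute intro!: sum_nonneg)
  have "(1 / (b \<bullet> x)) *\<^sub>R b \<in> subdifferential infnorm x"
    by (rule sign_compatible_infnorm_subgradient)
      (use x b False \<open>b \<bullet> x \<ge> 0\<close> in auto)
  then show thesis
    using that False by simp
qed

lemma eigenpair_cut_vec:
  fixes E :: "'n::finite set set"
  assumes G: "weighted_graph E w"
  shows "eigenpair E w (boundary_weight E w A / min (vol E w A) (vol E w (- A))) (cut_vec A)"
proof -
  let ?x = "cut_vec A"
  define m where "m = min (vol E w A) (vol E w (- A))"
  define \<mu> where "\<mu> = boundary_weight E w A / m"
  obtain s where s: "s \<in> subdifferential (I_plus E w) ?x" "\<And>i. ?x $ i * s $ i \<ge> 0"
    by (rule exists_sign_compatible_I_plus_subgradient[OF G, of ?x]) auto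
  obtain v where v: "v \<in> subdifferential (N_fun E w) ?x" "\<And>i. ?x $ i * v $ i \<ge> 0"
    and N: "N_fun E w ?x = 2 * m"
    unfolding m_def using exists_cut_vec_N_fun_subgradient[OF G] by blast
  \<comment> \<open>The bound by \<open>m\<close> gives
    \<open>\<mu> * m = boundary_weight E w A\<close> even for \<open>m = 0\<close>: then the
    boundary weight is 0, and so is \<open>\<mu>\<close> by division by zero.\<close>
  have "0 \<le> m" "0 \<le> boundary_weight E w A" "boundary_weight E w A \<le> m"
    using vol_nonneg[OF G] boundary_weight_nonneg[OF G] boundary_weight_le_vol[OF G, of A]
      boundary_weight_le_vol[OF G, of "- A"]
    by (auto simp: m_def boundary_weight_Compl)
  then have "\<mu> \<ge> 0" and \<mu>: "\<mu> * m = boundary_weight E w A"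
    by (auto simp: \<mu>_def)
  have "s \<bullet> ?x = I_plus E w ?x" "v \<bullet> ?x = N_fun E w ?x"
    using s(1) v(1) by (auto simp: subdifferential_I_plus_iff subdifferential_N_fun_iff[OF G])
  \<comment> \<open>The term \<open>2 * \<mu> * m\<close> from \<open>N_fun\<close> restores the
    twice-counted boundary weight that \<open>I_plus\<close> lacks.\<close>
  then have b: "(s + \<mu> *\<^sub>R v) \<bullet> ?x = vol E w UNIV"
    using \<mu> by (simp add: inner_add_left I_plus_cut_vec[OF G] N)
  have sgn_b: "?x $ i * (s + \<mu> *\<^sub>R v) $ i \<ge> 0" for i
    using s(2)[of i] mult_nonneg_nonneg[OF \<open>\<mu> \<ge> 0\<close> v(2)[of i]]
    by (simp add: distrib_left mult.left_commute)
  have "\<bar>?x $ i\<bar> = 1" for i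
    by simp
  then obtain u where "u \<in> subdifferential infnorm ?x"
    "vol E w UNIV *\<^sub>R u = s + \<mu> *\<^sub>R v"
    using exists_scaled_infnorm_subgradient[of ?x "s + \<mu> *\<^sub>R v", OF _ sgn_b] unfolding b by blast
  moreover have "?x \<noteq> 0"
    by (auto simp: vec_eq_iff)
  ultimately have "eigenpair E w \<mu> ?x"
    using s(1) v(1) unfolding eigenpair_def signless_one_Laplacian_def
    by (metis add_diff_cancel_left' diff_self)
  then show ?thesis
    by (simp add: \<mu>_def m_def)
qed

theorem theorem2p2:
  fixes E :: "'n::finite set set" and w :: "'n set \<Rightarrow> real"
  assumes "weighted_graph E w"
  shows "(\<forall>A. A \<noteq> {} \<and> A \<noteq> UNIV \<longrightarrow>
            eigenpair E w (boundary_weight E w A / min (vol E w A) (vol E w (- A)))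
              (indicator_vec A - indicator_vec (- A))) \<and>
         (\<forall>\<mu> x. eigenpair E w \<mu> x \<and> \<not> (\<exists>c. \<forall>i. x $ i = c) \<longrightarrow>
            ((\<forall>i. wdegree E w i > 0) \<longrightarrow> N_fun E w x \<noteq> 0) \<and>
            (N_fun E w x \<noteq> 0 \<longrightarrow>
               (vol E w UNIV * infnorm x - I_plus E w x) / N_fun E w x = \<mu>)) \<and>
         (\<forall>\<mu> x. eigenpair E w \<mu> x \<longrightarrow>
            eigenpair E w \<mu> (indicator_vec {i. x $ i > 0} - indicator_vec {i. x $ i < 0}))"
proof (intro conjI allI impI)
  fix A :: "'n set"
  show "eigenpair E w (boundary_weight E w A / min (vol E w A) (vol E w (- A)))
      (indicator_vec A - indicator_vec (- A))"
    using eigenpair_cut_vec[OF assms, of A] by (simp only: cut_vec_def)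
next
  fix \<mu> x
  assume x: "eigenpair E w \<mu> x \<and> \<not> (\<exists>c. \<forall>i. x $ i = c)"
  show "N_fun E w x \<noteq> 0" if "\<forall>i. wdegree E w i > 0"
    using x that N_fun_eq_0_imp_constant[OF assms, of x] by blast
  show "(vol E w UNIV * infnorm x - I_plus E w x) / N_fun E w x = \<mu>" if "N_fun E w x \<noteq> 0"
    using x that eigenpair_eigenvalue[OF assms, of \<mu> x] by simp
next
  fix \<mu> x
  assume "eigenpair E w \<mu> x"
  then show "eigenpair E w \<mu> (indicator_vec {i. x $ i > 0} - indicator_vec {i. x $ i < 0})"
    using eigenpair_sgn_vec[OF assms] by (simp only: indicator_diff_eq_sgn_vec)
qed

end
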